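(* Let $V$ be a finite set and let $(V,\le)$ be a functional partial order. Then $$\operatorname{NDS}\bigl(\mathcal{I}(V,\le)\bigr)\le 0 .$$
   Context: The functional preorder on $V$ induced by a function $f\colon V\to V$ is the reflexive-transitive closure of the relation $\lessdot$ defined by $v\lessdot w$ if and only if $f(v)=w$ and $f(v)\neq v$. A functional partial order is a functional preorder (induced by some $f\colon V\to V$) that is a partial order, i.e. is antisymmetric. For a preordered set $(V,\le)$, a subset $I\subseteq V$ is an order ideal if $x\in I$ and $y\le x$ imply $y\in I$; $\mathcal{I}(V,\le)$ denotes the family of all order ideals. For a family $\mathcal F\subseteq 2^V$ of subsets of a finite ground set $V$, the normalized degree sum is the integer $\operatorname{NDS}(\mathcal F)=2\sum_{F\in\mathcal F}|F|-|\mathcal F|\,|V|$. *)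

theory Defs
  imports Main
begin

definition functional_cover :: "'a set \<Rightarrow> ('a \<Rightarrow> 'a) \<Rightarrow> 'a rel" where
  "functional_cover V f = {(v, w). v \<in> V \<and> w \<in> V \<and> f v = w \<and> f v \<noteq> v}"

text \<open>
  A pair \<open>(v, w)\<close> in a relation is read as \<open>v \<le> w\<close>. The intersection with \<open>V \<times> V\<close> only makes
  the closure reflexive on \<open>V\<close> instead of on the whole type.
\<close>

definition functional_preorder_of :: "'a set \<Rightarrow> ('a \<Rightarrow> 'a) \<Rightarrow> 'a rel" where
  "functional_preorder_of V f = (functional_cover V f)\<^sup>* \<inter> V \<times> V"

definition functional_preorder_on :: "'a set \<Rightarrow> 'a rel \<Rightarrow> bool" where
  "functional_preorder_on V r \<longleftrightarrow> (\<exists>f. f ` V \<subseteq> V \<and> r = functional_preorder_of V f)"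

definition functional_partial_order_on :: "'a set \<Rightarrow> 'a rel \<Rightarrow> bool" where
  "functional_partial_order_on V r \<longleftrightarrow> functional_preorder_on V r \<and> partial_order_on V r"

definition order_ideal :: "'a set \<Rightarrow> 'a rel \<Rightarrow> 'a set \<Rightarrow> bool" where
  "order_ideal V r I \<longleftrightarrow> I \<subseteq> V \<and> (\<forall>x\<in>I. \<forall>y\<in>V. (y, x) \<in> r \<longrightarrow> y \<in> I)"

definition order_ideals :: "'a set \<Rightarrow> 'a rel \<Rightarrow> 'a set set" where
  "order_ideals V r = {I. order_ideal V r I}"

definition NDS :: "'a set \<Rightarrow> 'a set set \<Rightarrow> int" where
  "NDS V F = 2 * (\<Sum>A\<in>F. int (card A)) - int (card F) * int (card V)"

end

theory Submission
  imports Defs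
begin

text \<open>
  The normalized degree sum is the number of pairs \<open>(I, v)\<close> with \<open>v \<in> I\<close> minus the number of
  pairs with \<open>v \<in> V - I\<close>, where \<open>I\<close> runs over the order ideals. Hence it suffices to map the
  pairs of the first kind injectively to pairs of the second kind.

  In a functional partial order the elements above a given one form a chain
  (\<open>functional_preorder_of_upper_bounds_comparable\<close>): they are the iterated images of that
  element under \<open>f\<close>. So for \<open>v \<in> I\<close> the elements of \<open>I\<close> above \<open>v\<close> have a greatest one,
  \<open>u\<close>. The map sends \<open>(I, v)\<close> to \<open>(J, u)\<close>, where \<open>J\<close> is \<open>I\<close> with everything above \<open>v\<close> removed;
  \<open>J\<close> is again an ideal, and \<open>u \<notin> J\<close>. Nothing is lost: the removed elements all lie between \<open>v\<close>
  and \<open>u\<close>, and \<open>I\<close> contains everything below \<open>u\<close>, so \<open>I\<close> is the union of \<open>J\<close> with the elements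
  below \<open>u\<close>, and \<open>v\<close> is the least element below \<open>u\<close> outside \<open>J\<close>.
\<close>

lemma NDS_eq_card_diff:
  assumes "finite V" "F \<subseteq> Pow V"
  shows "NDS V F = int (card (SIGMA A:F. A)) - int (card (SIGMA A:F. V - A))"
proof -
  have fin: "finite F" "\<And>A. A \<in> F \<Longrightarrow> finite A"
    using assms finite_subset by (blast, blast)
  have compl: "int (card (V - A)) = int (card V) - int (card A)" if "A \<in> F" for A
    using that assms fin(2) by (auto simp: card_Diff_subset of_nat_diff card_mono)
  have "int (card (SIGMA A:F. A)) = (\<Sum>A\<in>F. int (card A))"
    using fin by simp
  moreover have "int (card (SIGMA A:F. V - A)) = int (card F) * int (card V) - (\<Sum>A\<in>F. int (card A))"
    using fin assms(1) compl by (simp add: sum_subtractf)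
  ultimately show ?thesis
    by (simp add: NDS_def)
qed

text \<open>
  Each element has at most one cover, so two ascending paths from the same element cannot branch:
  one of them extends the other.
\<close>

lemma functional_preorder_of_upper_bounds_comparable:
  assumes "(x, y) \<in> functional_preorder_of V f" "(x, z) \<in> functional_preorder_of V f"
  shows "(y, z) \<in> functional_preorder_of V f \<or> (z, y) \<in> functional_preorder_of V f"
proof -
  have "single_valued (functional_cover V f)"
    by (auto simp: single_valued_def functional_cover_def)
  then show ?thesis
    using assms single_valued_confluent[of "functional_cover V f" x y z]
    by (auto simp: functional_preorder_of_def)
qed

lemma finite_chain_has_greatest:
  assumes "finite C" "C \<noteq> {}" "trans r"
    and chain: "\<And>x y. x \<in> C \<Longrightarrow> y \<in> C \<Longrightarrow> (x, y) \<in> r \<or> (y, x) \<in> r"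
  shows "\<exists>u\<in>C. \<forall>x\<in>C. (x, u) \<in> r"
  using assms(1,2) chain
proof (induction rule: finite_ne_induct)
  case (singleton x)
  then show ?case by blast
next
  case (insert x C)
  then obtain u where u: "u \<in> C" "\<forall>y\<in>C. (y, u) \<in> r"
    by blast
  show ?case
  proof (cases "(x, u) \<in> r")
    case True
    then show ?thesis using u by blast
  next
    case False
    then have "(u, x) \<in> r" "(x, x) \<in> r"
      using insert.prems u(1) by blast+
    then show ?thesis
      using u \<open>trans r\<close> by (blast dest: transD)
  qed
qed

lemma order_ideal_removing_above:
  assumes "order_ideal V r I" "trans r"
  shows "order_ideal V r {x \<in> I. (v, x) \<notin> r}"
  using assms unfolding order_ideal_def by (blast dest: transD)

text \<open>
  The injection needs an upper bound \<open>u\<close> of the removed elements that lies in \<open>I\<close> itself; since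
  the removed elements form a chain, their greatest element is one.
\<close>

lemma card_members_le_card_nonmembers:
  assumes "finite V" "partial_order_on V r"
    and comparable: "\<And>x y z. (x, y) \<in> r \<Longrightarrow> (x, z) \<in> r \<Longrightarrow> (y, z) \<in> r \<or> (z, y) \<in> r"
  shows "card (SIGMA I:order_ideals V r. I) \<le> card (SIGMA I:order_ideals V r. V - I)"
proof -
  have po: "refl_on V r" "trans r" "antisym r"
    using assms(2) by (auto simp: partial_order_on_def preorder_on_def)
  have sub: "I \<subseteq> V" if "I \<in> order_ideals V r" for I
    using that by (auto simp: order_ideals_def order_ideal_def)
  have fin: "finite (order_ideals V r)"
    using \<open>finite V\<close> sub by (meson Pow_iff finite_Pow_iff finite_subset subsetI)
  let ?above = "\<lambda>I v. {x \<in> I. (v, x) \<in> r}"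
  let ?rest = "\<lambda>I v. {x \<in> I. (v, x) \<notin> r}"
  define g where "g I v = (SOME u. u \<in> ?above I v \<and> (\<forall>x\<in>?above I v. (x, u) \<in> r))" for I v
  have g: "g I v \<in> I" "(v, g I v) \<in> r" "\<And>x. x \<in> I \<Longrightarrow> (v, x) \<in> r \<Longrightarrow> (x, g I v) \<in> r"
    if "I \<in> order_ideals V r" "v \<in> I" for I v
  proof -
    have "\<exists>u\<in>?above I v. \<forall>x\<in>?above I v. (x, u) \<in> r"
    proof (rule finite_chain_has_greatest)
      show "finite (?above I v)"
        using sub[OF that(1)] \<open>finite V\<close> by (simp add: finite_subset)
      show "?above I v \<noteq> {}"
        using that sub po(1) by (auto dest: refl_onD)
      show "trans r"
        by (rule po(2))
      show "(x, y) \<in> r \<or> (y, x) \<in> r" if "x \<in> ?above I v" "y \<in> ?above I v" for x y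
        using that comparable[of v x y] by simp
    qed
    then have "\<exists>u. u \<in> ?above I v \<and> (\<forall>x\<in>?above I v. (x, u) \<in> r)"
      by blast
    then have "g I v \<in> ?above I v \<and> (\<forall>x\<in>?above I v. (x, g I v) \<in> r)"
      unfolding g_def by (rule someI_ex)
    then show "g I v \<in> I" "(v, g I v) \<in> r" "\<And>x. x \<in> I \<Longrightarrow> (v, x) \<in> r \<Longrightarrow> (x, g I v) \<in> r"
      by simp_all
  qed
  have down: "y \<in> I" if "I \<in> order_ideals V r" "x \<in> I" "(y, x) \<in> r" "y \<in> V" for I x y
    using that by (auto simp: order_ideals_def order_ideal_def)
  let ?h = "\<lambda>(I, v). (?rest I v, g I v)"
  have recover_ideal: "I = ?rest I v \<union> {x \<in> V. (x, g I v) \<in> r}"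
    if "I \<in> order_ideals V r" "v \<in> I" for I v
  proof
    show "I \<subseteq> ?rest I v \<union> {x \<in> V. (x, g I v) \<in> r}"
      using g(3)[OF that] sub[OF that(1)] by auto
    show "?rest I v \<union> {x \<in> V. (x, g I v) \<in> r} \<subseteq> I"
      using down[OF that(1) g(1)[OF that]] by auto
  qed
  have "inj_on ?h (SIGMA I:order_ideals V r. I)"
  proof (rule inj_onI, clarify)
    fix I v I' v'
    assume I: "I \<in> order_ideals V r" "v \<in> I" and I': "I' \<in> order_ideals V r" "v' \<in> I'"
      and rest: "?rest I v = ?rest I' v'" and top: "g I v = g I' v'"
    have "I = ?rest I' v' \<union> {x \<in> V. (x, g I' v') \<in> r}"
      using recover_ideal[OF I] unfolding rest top .
    also have "\<dots> = I'"
      using recover_ideal[OF I'] by (rule sym)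
    finally have "I = I'" .
    \<comment> \<open>Now the same elements have been removed from the same ideal, and \<open>v\<close> and \<open>v'\<close> are both
      the least of them.\<close>
    then have "?above I v = ?above I v'"
      using rest by blast
    moreover have "(v, v) \<in> r" "(v', v') \<in> r"
      using I I' sub po(1) by (auto dest: refl_onD)
    ultimately have "(v, v') \<in> r" "(v', v) \<in> r"
      using I I' \<open>I = I'\<close> by blast+
    then show "I = I' \<and> v = v'"
      using \<open>I = I'\<close> po(3) by (auto dest: antisymD)
  qed
  moreover have "?h ` (SIGMA I:order_ideals V r. I) \<subseteq> (SIGMA I:order_ideals V r. V - I)"
  proof -
    have "?rest I v \<in> order_ideals V r" "g I v \<in> V - ?rest I v"
      if "I \<in> order_ideals V r" "v \<in> I" for I v
      using that(1) order_ideal_removing_above[OF _ po(2)] g(1,2)[OF that] sub[OF that(1)]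
      by (auto simp: order_ideals_def)
    then show ?thesis
      by auto
  qed
  moreover have "finite (SIGMA I:order_ideals V r. V - I)"
    using fin \<open>finite V\<close> by simp
  ultimately show ?thesis
    by (rule card_inj_on_le)
qed

theorem theorem2p9:
  fixes V :: "'a set" and r :: "'a rel"
  assumes "finite V"
    and "functional_partial_order_on V r"
  shows "NDS V (order_ideals V r) \<le> 0"
proof -
  obtain f where r: "r = functional_preorder_of V f" and po: "partial_order_on V r"
    using assms(2) by (auto simp: functional_partial_order_on_def functional_preorder_on_def)
  have "card (SIGMA I:order_ideals V r. I) \<le> card (SIGMA I:order_ideals V r. V - I)"
    using assms(1) po
  proof (rule card_members_le_card_nonmembers)
    show "(y, z) \<in> r \<or> (z, y) \<in> r" if "(x, y) \<in> r" "(x, z) \<in> r" for x y z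
      using that unfolding r by (rule functional_preorder_of_upper_bounds_comparable)
  qed
  moreover have "order_ideals V r \<subseteq> Pow V"
    by (auto simp: order_ideals_def order_ideal_def)
  ultimately show ?thesis
    using NDS_eq_card_diff[OF assms(1)] by simp
qed

end
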